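(* Let $(X,r)$ be a right-non-degenerate (RND) solution, and let $k$ be a reflection for $(X,r)$. Then the right translations $a\mapsto a\blacktriangleleft_k b$ ($b\in X$) extend to a left action of the structure monoid $M(X,r^{(k)})$ on $X$; that is, there is a left monoid action of $M(X,r^{(k)})$ on the set $X$ in which each generator $b\in X$ acts by $b\cdot a=a\blacktriangleleft_k b$ for all $a\in X$.
   Context: Products of maps denote composition, the rightmost map being applied first. For a map $\phi\colon X^m\to X^m$, $\phi_i$ denotes the map on $X^n$ that applies $\phi$ to the $m$ consecutive coordinates starting at position $i$ and is the identity on the others. A solution $(X,r)$ is a set $X$ with a map $r\colon X\times X\to X\times X$ (not assumed bijective) satisfying the Yang–Baxter equation $r_1r_2r_1=r_2r_1r_2$ on $X^3$; write $r(a,b)=(\lambda_a(b),\rho_b(a))$. It is right-non-degenerate (RND) if all maps $\rho_b\colon X\to X$ are bijective. A reflection for $(X,r)$ is a map $k\colon X\to X$ with $r k_2 r k_2=k_2 r k_2 r$ on $X^2$. For an RND solution and a reflection $k$, the $k$-derived solution is the map $r^{(k)}\colon X\times X\to X\times X$, $r^{(k)}(a,b)=(b',a')$, where $a'=\rho_b\rho_{k(b)}^{-1}(a)$ and $b'=\rho_{k(a')}\lambda_{\rho_{k(b)}^{-1}(a)}(b)$. It is again an RND solution. Its structure monoid is $M(X,r^{(k)})=\langle a\in X\mid ab=b'a'\text{ whenever } r^{(k)}(a,b)=(b',a')\rangle$. The operation $\blacktriangleleft_k$ on $X$ is $a\blacktriangleleft_k b=\rho_{k(b)}\lambda_{\rho_a^{-1}(b)}(a)$.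 *)

theory Defs
  imports "HOL-Algebra.Group"
begin

text \<open>
  A triple \<open>(a, b, c)\<close> is \<open>(a, (b, c))\<close>, so \<open>map_prod id r\<close> is $r_2$ on $X^3$,
  whereas $r_1$ needs reassociation. Likewise \<open>map_prod id k\<close> is $k_2$ on $X^2$.
  All maps are total functions on a type; only their values on the carrier \<open>X\<close> matter.
\<close>

definition on12 :: "('a \<times> 'a \<Rightarrow> 'a \<times> 'a) \<Rightarrow> 'a \<times> 'a \<times> 'a \<Rightarrow> 'a \<times> 'a \<times> 'a" where
  "on12 r = (\<lambda>(a, b, c). case r (a, b) of (u, v) \<Rightarrow> (u, v, c))"

definition on23 :: "('a \<times> 'a \<Rightarrow> 'a \<times> 'a) \<Rightarrow> 'a \<times> 'a \<times> 'a \<Rightarrow> 'a \<times> 'a \<times> 'a" where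
  "on23 r = map_prod id r"

definition on2 :: "('a \<Rightarrow> 'a) \<Rightarrow> 'a \<times> 'a \<Rightarrow> 'a \<times> 'a" where
  "on2 k = map_prod id k"

definition ybe_solution :: "'a set \<Rightarrow> ('a \<times> 'a \<Rightarrow> 'a \<times> 'a) \<Rightarrow> bool" where
  "ybe_solution X r \<longleftrightarrow>
     r \<in> X \<times> X \<rightarrow> X \<times> X \<and>
     (\<forall>t \<in> X \<times> X \<times> X. (on12 r \<circ> on23 r \<circ> on12 r) t = (on23 r \<circ> on12 r \<circ> on23 r) t)"

definition lam :: "('a \<times> 'a \<Rightarrow> 'a \<times> 'a) \<Rightarrow> 'a \<Rightarrow> 'a \<Rightarrow> 'a" where
  "lam r a b = fst (r (a, b))"

definition rho :: "('a \<times> 'a \<Rightarrow> 'a \<times> 'a) \<Rightarrow> 'a \<Rightarrow> 'a \<Rightarrow> 'a" where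
  "rho r b a = snd (r (a, b))"

definition rnd_solution :: "'a set \<Rightarrow> ('a \<times> 'a \<Rightarrow> 'a \<times> 'a) \<Rightarrow> bool" where
  "rnd_solution X r \<longleftrightarrow> ybe_solution X r \<and> (\<forall>b \<in> X. bij_betw (rho r b) X X)"

definition rho_inv :: "'a set \<Rightarrow> ('a \<times> 'a \<Rightarrow> 'a \<times> 'a) \<Rightarrow> 'a \<Rightarrow> 'a \<Rightarrow> 'a" where
  "rho_inv X r b = inv_into X (rho r b)"

definition reflection :: "'a set \<Rightarrow> ('a \<times> 'a \<Rightarrow> 'a \<times> 'a) \<Rightarrow> ('a \<Rightarrow> 'a) \<Rightarrow> bool" where
  "reflection X r k \<longleftrightarrow>
     k \<in> X \<rightarrow> X \<and>
     (\<forall>p \<in> X \<times> X. (r \<circ> on2 k \<circ> r \<circ> on2 k) p = (on2 k \<circ> r \<circ> on2 k \<circ> r) p)"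

definition derived_solution ::
    "'a set \<Rightarrow> ('a \<times> 'a \<Rightarrow> 'a \<times> 'a) \<Rightarrow> ('a \<Rightarrow> 'a) \<Rightarrow> 'a \<times> 'a \<Rightarrow> 'a \<times> 'a" where
  "derived_solution X r k = (\<lambda>(a, b).
     let a' = rho r b (rho_inv X r (k b) a);
         b' = rho r (k a') (lam r (rho_inv X r (k b) a) b)
     in (b', a'))"

definition btri :: "'a set \<Rightarrow> ('a \<times> 'a \<Rightarrow> 'a \<times> 'a) \<Rightarrow> ('a \<Rightarrow> 'a) \<Rightarrow> 'a \<Rightarrow> 'a \<Rightarrow> 'a" where
  "btri X r k a b = rho r (k b) (lam r (rho_inv X r a b) a)"


text \<open>
  The structure monoid of \<open>(X, s)\<close>: words over \<open>X\<close> modulo the congruence generated by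
  $ab = b'a'$ whenever $s(a,b) = (b',a')$.
\<close>

inductive word_cong :: "'a set \<Rightarrow> ('a \<times> 'a \<Rightarrow> 'a \<times> 'a) \<Rightarrow> 'a list \<Rightarrow> 'a list \<Rightarrow> bool"
  for X :: "'a set" and s :: "'a \<times> 'a \<Rightarrow> 'a \<times> 'a"
where
  rel: "a \<in> X \<Longrightarrow> b \<in> X \<Longrightarrow> s (a, b) = (b', a') \<Longrightarrow> word_cong X s [a, b] [b', a']"
| refl: "u \<in> lists X \<Longrightarrow> word_cong X s u u"
| sym: "word_cong X s u v \<Longrightarrow> word_cong X s v u"
| trans: "word_cong X s u v \<Longrightarrow> word_cong X s v w \<Longrightarrow> word_cong X s u w"
| mult: "word_cong X s u v \<Longrightarrow> word_cong X s u' v' \<Longrightarrow> word_cong X s (u @ u') (v @ v')"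

definition word_rel :: "'a set \<Rightarrow> ('a \<times> 'a \<Rightarrow> 'a \<times> 'a) \<Rightarrow> ('a list \<times> 'a list) set" where
  "word_rel X s = {(u, v). word_cong X s u v}"

definition word_class :: "'a set \<Rightarrow> ('a \<times> 'a \<Rightarrow> 'a \<times> 'a) \<Rightarrow> 'a list \<Rightarrow> 'a list set" where
  "word_class X s u = word_rel X s `` {u}"

definition structure_monoid :: "'a set \<Rightarrow> ('a \<times> 'a \<Rightarrow> 'a \<times> 'a) \<Rightarrow> 'a list set monoid" where
  "structure_monoid X s =
     \<lparr>carrier = lists X // word_rel X s,
      mult = (\<lambda>A B. \<Union>u\<in>A. \<Union>v\<in>B. word_class X s (u @ v)),
      one = word_class X s []\<rparr>"

definition generator :: "'a set \<Rightarrow> ('a \<times> 'a \<Rightarrow> 'a \<times> 'a) \<Rightarrow> 'a \<Rightarrow> 'a list set" where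
  "generator X s b = word_class X s [b]"

lemma word_cong_lists:
  assumes "s \<in> X \<times> X \<rightarrow> X \<times> X" and "word_cong X s u v"
  shows "u \<in> lists X \<and> v \<in> lists X"
  using assms(2)
proof induction
  case (rel a b b' a')
  then have "s (a, b) \<in> X \<times> X"
    using assms(1) by blast
  with rel show ?case
    by auto
qed auto

lemma equiv_word_rel:
  assumes "s \<in> X \<times> X \<rightarrow> X \<times> X"
  shows "equiv (lists X) (word_rel X s)"
proof (rule equivI)
  show "word_rel X s \<subseteq> lists X \<times> lists X"
    using word_cong_lists[OF assms] by (auto simp: word_rel_def)
  show "refl_on (lists X) (word_rel X s)"
    by (auto simp: refl_on_def word_rel_def intro: word_cong.refl)
  show "Relation.sym (word_rel X s)"
    by (auto simp: sym_def word_rel_def intro: word_cong.sym)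
  show "Relation.trans (word_rel X s)"
    by (auto simp: trans_def word_rel_def intro: word_cong.trans)
qed

lemma structure_monoid_mult:
  assumes "s \<in> X \<times> X \<rightarrow> X \<times> X" and "u \<in> lists X" and "v \<in> lists X"
  shows "word_class X s u \<otimes>\<^bsub>structure_monoid X s\<^esub> word_class X s v = word_class X s (u @ v)"
proof -
  have "word_class X s (u' @ v') = word_class X s (u @ v)"
    if "u' \<in> word_class X s u" "v' \<in> word_class X s v" for u' v'
  proof -
    have "(u @ v, u' @ v') \<in> word_rel X s"
      using that by (auto simp: word_class_def word_rel_def intro: word_cong.mult)
    then show ?thesis
      using equiv_class_eq[OF equiv_word_rel[OF assms(1)]] by (simp add: word_class_def)
  qed
  moreover have "u \<in> word_class X s u" "v \<in> word_class X s v"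
    using assms(2,3) by (auto simp: word_class_def word_rel_def intro: word_cong.refl)
  ultimately have "(\<Union>u'\<in>word_class X s u. \<Union>v'\<in>word_class X s v. word_class X s (u' @ v'))
      = word_class X s (u @ v)"
    by blast
  then show ?thesis
    by (simp add: structure_monoid_def)
qed

lemma monoid_structure_monoid:
  assumes "s \<in> X \<times> X \<rightarrow> X \<times> X"
  shows "monoid (structure_monoid X s)"
proof -
  have car: "A \<in> carrier (structure_monoid X s) \<longleftrightarrow> (\<exists>u\<in>lists X. A = word_class X s u)" for A
    by (auto simp: structure_monoid_def word_class_def quotient_def)
  have one: "\<one>\<^bsub>structure_monoid X s\<^esub> = word_class X s []"
    by (simp add: structure_monoid_def)
  note m = structure_monoid_mult[OF assms]
  have app: "u @ v \<in> lists X" if "u \<in> lists X" "v \<in> lists X" for u v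
    using that by simp
  show ?thesis
  proof (rule monoidI)
    fix A B assume "A \<in> carrier (structure_monoid X s)" "B \<in> carrier (structure_monoid X s)"
    then show "A \<otimes>\<^bsub>structure_monoid X s\<^esub> B \<in> carrier (structure_monoid X s)"
      unfolding car using m app by metis
  next
    show "\<one>\<^bsub>structure_monoid X s\<^esub> \<in> carrier (structure_monoid X s)"
      unfolding car one by blast
  next
    fix A B C
    assume "A \<in> carrier (structure_monoid X s)" "B \<in> carrier (structure_monoid X s)"
      "C \<in> carrier (structure_monoid X s)"
    then obtain u v w where "u \<in> lists X" "v \<in> lists X" "w \<in> lists X"
      "A = word_class X s u" "B = word_class X s v" "C = word_class X s w"
      unfolding car by blast
    then show "A \<otimes>\<^bsub>structure_monoid X s\<^esub> B \<otimes>\<^bsub>structure_monoid X s\<^esub> C =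
        A \<otimes>\<^bsub>structure_monoid X s\<^esub> (B \<otimes>\<^bsub>structure_monoid X s\<^esub> C)"
      by (simp add: m del: in_lists_conv_set)
  next
    fix A assume "A \<in> carrier (structure_monoid X s)"
    then obtain u where u: "u \<in> lists X" "A = word_class X s u"
      unfolding car by blast
    show "\<one>\<^bsub>structure_monoid X s\<^esub> \<otimes>\<^bsub>structure_monoid X s\<^esub> A = A"
      using m[OF _ u(1), of "[]"] by (simp add: one u(2))
    show "A \<otimes>\<^bsub>structure_monoid X s\<^esub> \<one>\<^bsub>structure_monoid X s\<^esub> = A"
      using m[OF u(1), of "[]"] by (simp add: one u(2))
  qed
qed


locale left_monoid_action = monoid M for M (structure) +
  fixes X :: "'b set" and act :: "'a \<Rightarrow> 'b \<Rightarrow> 'b"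
  assumes act_closed: "m \<in> carrier M \<Longrightarrow> x \<in> X \<Longrightarrow> act m x \<in> X"
    and act_one: "x \<in> X \<Longrightarrow> act \<one> x = x"
    and act_mult: "m \<in> carrier M \<Longrightarrow> n \<in> carrier M \<Longrightarrow> x \<in> X \<Longrightarrow>
      act (m \<otimes> n) x = act m (act n x)"

end

theory Submission
  imports Defs
begin

text \<open>
  A monoid given by generators and relations acts as soon as its generators do so compatibly with
  the defining relations (lemma \<open>structure_monoid_action\<close>). The content is therefore the identity
  $(x \blacktriangleleft b) \blacktriangleleft a = (x \blacktriangleleft a') \blacktriangleleft b'$
  whenever $r^{(k)}(a,b) = (b',a')$ (lemma \<open>btri_compatible\<close>).

  The inverses $\rho^{-1}$ in the definitions disappear in suitable coordinates. Since every
  $\rho$ is bijective, $b = \rho_x(q)$ and $a' = \rho_x\rho_q(t)$ for unique $q, t \in X$.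
  With $p = \rho_{\lambda_q(x)}(t)$ the Yang--Baxter equation gives $a' = \rho_b(p)$, so that
  $a = \rho_{k(b)}(p)$ and $b' = \rho_{k(a')}(c)$ where $c = \lambda_p(b)$.
  One computation with the Yang--Baxter equation (lemma \<open>btri_rho\<close>) evaluates an operation
  $\rho_v(y) \blacktriangleleft \rho_v\rho_y(t)$ without inverses. Both sides of the identity have
  this form, and further Yang--Baxter steps turn them into
  $\rho_{\rho_{k(a)}(d)}\,\rho_{\lambda_d(k(a))}\,\lambda_t\lambda_q(x)$ with
  $d = \lambda_p(k(b))$ on the left, and
  $\rho_{k(b')}\,\rho_{\lambda_c(k(a'))}\,\lambda_t\lambda_q(x)$ on the right.
  The two components of the reflection equation at $(p,b)$ say precisely that
  $\lambda_d(k(a)) = \lambda_c(k(a'))$ and $\rho_{k(a)}(d) = k(b')$.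
\<close>

lemma structure_monoid_action:
  fixes f :: "'a \<Rightarrow> 'b \<Rightarrow> 'b"
  assumes s: "s \<in> X \<times> X \<rightarrow> X \<times> X"
    and closed: "\<And>b x. b \<in> X \<Longrightarrow> x \<in> Y \<Longrightarrow> f b x \<in> Y"
    and compatible: "\<And>a b a' b' x. a \<in> X \<Longrightarrow> b \<in> X \<Longrightarrow> s (a, b) = (b', a') \<Longrightarrow> x \<in> Y \<Longrightarrow>
      f a (f b x) = f b' (f a' x)"
  shows "\<exists>act. left_monoid_action (structure_monoid X s) Y act \<and>
    (\<forall>b \<in> X. \<forall>x \<in> Y. act (generator X s b) x = f b x)"
proof -
  have closed_word: "foldr f u x \<in> Y" if "u \<in> lists X" "x \<in> Y" for u x
    using that by (induction u) (auto intro: closed)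
  have cong: "foldr f u x = foldr f v x" if "word_cong X s u v" "x \<in> Y" for u v x
    using that
  proof (induction arbitrary: x)
    case (rel a b b' a')
    then show ?case
      by (simp add: compatible)
  next
    case (mult u v u' v')
    then have "u' \<in> lists X"
      using word_cong_lists[OF s] by blast
    then have "foldr f u' x \<in> Y"
      using mult.prems by (rule closed_word)
    with mult show ?case
      by simp
  qed auto
  define act where "act A x = foldr f (SOME u. u \<in> A) x" for A :: "'a list set" and x
  have act_class: "act (word_class X s u) x = foldr f u x" if "u \<in> lists X" "x \<in> Y" for u x
  proof -
    have "u \<in> word_class X s u"
      using that by (auto simp: word_class_def word_rel_def intro: word_cong.refl)
    then have "(SOME v. v \<in> word_class X s u) \<in> word_class X s u"
      by (rule someI)
    then have "word_cong X s u (SOME v. v \<in> word_class X s u)"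
      by (simp add: word_class_def word_rel_def)
    then show ?thesis
      unfolding act_def using cong that(2) by metis
  qed
  have carrierE: "\<exists>u\<in>lists X. A = word_class X s u" if "A \<in> carrier (structure_monoid X s)" for A
    using that by (auto simp: structure_monoid_def word_class_def quotient_def)
  have "left_monoid_action (structure_monoid X s) Y act"
  proof (intro left_monoid_action.intro monoid_structure_monoid[OF s]
      left_monoid_action_axioms.intro)
    fix A x assume "A \<in> carrier (structure_monoid X s)" "x \<in> Y"
    then show "act A x \<in> Y"
      using carrierE act_class closed_word by metis
  next
    fix x assume "x \<in> Y"
    then show "act \<one>\<^bsub>structure_monoid X s\<^esub> x = x"
      using act_class[of "[]"] by (simp add: structure_monoid_def)
  next
    fix A B x
    assume "A \<in> carrier (structure_monoid X s)" "B \<in> carrier (structure_monoid X s)" "x \<in> Y"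
    then obtain u v where "u \<in> lists X" "A = word_class X s u" "v \<in> lists X" "B = word_class X s v"
      using carrierE by metis
    with \<open>x \<in> Y\<close> show "act (A \<otimes>\<^bsub>structure_monoid X s\<^esub> B) x = act A (act B x)"
      using closed_word[of v x] append_in_lists_conv[of u v X]
      by (simp add: structure_monoid_mult[OF s] act_class del: in_lists_conv_set)
  qed
  moreover have "act (generator X s b) x = f b x" if "b \<in> X" "x \<in> Y" for b x
    using act_class[of "[b]" x] that by (simp add: generator_def)
  ultimately show ?thesis
    by blast
qed

locale rnd_with_reflection =
  fixes X :: "'a set" and r :: "'a \<times> 'a \<Rightarrow> 'a \<times> 'a" and k :: "'a \<Rightarrow> 'a"
  assumes rnd: "rnd_solution X r" and refl: "reflection X r k"
begin

lemma r_eq: "r (a, b) = (lam r a b, rho r b a)"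
  by (simp add: lam_def rho_def)

lemma lam_closed [simp]: "a \<in> X \<Longrightarrow> b \<in> X \<Longrightarrow> lam r a b \<in> X"
  and rho_closed [simp]: "a \<in> X \<Longrightarrow> b \<in> X \<Longrightarrow> rho r b a \<in> X"
  and k_closed [simp]: "a \<in> X \<Longrightarrow> k a \<in> X"
proof -
  have "r \<in> X \<times> X \<rightarrow> X \<times> X"
    using rnd by (simp add: rnd_solution_def ybe_solution_def)
  then have "r (a, b) \<in> X \<times> X" if "a \<in> X" "b \<in> X" for a b
    using that by blast
  then show "a \<in> X \<Longrightarrow> b \<in> X \<Longrightarrow> lam r a b \<in> X" "a \<in> X \<Longrightarrow> b \<in> X \<Longrightarrow> rho r b a \<in> X"
    unfolding r_eq by auto
  show "a \<in> X \<Longrightarrow> k a \<in> X"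
    using refl by (auto simp: reflection_def)
qed

lemma rho_inv_closed [simp]: "a \<in> X \<Longrightarrow> b \<in> X \<Longrightarrow> rho_inv X r b a \<in> X"
  and rho_rho_inv [simp]: "a \<in> X \<Longrightarrow> b \<in> X \<Longrightarrow> rho r b (rho_inv X r b a) = a"
  and rho_inv_rho [simp]: "a \<in> X \<Longrightarrow> b \<in> X \<Longrightarrow> rho_inv X r b (rho r b a) = a"
proof -
  have bij: "bij_betw (rho r b) X X" if "b \<in> X" for b
    using rnd that by (simp add: rnd_solution_def)
  show "a \<in> X \<Longrightarrow> b \<in> X \<Longrightarrow> rho_inv X r b a \<in> X"
    unfolding rho_inv_def using bij bij_betw_imp_surj_on inv_into_into by metis
  show "a \<in> X \<Longrightarrow> b \<in> X \<Longrightarrow> rho r b (rho_inv X r b a) = a"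
    unfolding rho_inv_def using bij by (metis bij_betw_inv_into_right)
  show "a \<in> X \<Longrightarrow> b \<in> X \<Longrightarrow> rho_inv X r b (rho r b a) = a"
    unfolding rho_inv_def using bij by (metis bij_betw_inv_into_left)
qed

lemma
  assumes "a \<in> X" "b \<in> X" "c \<in> X"
  shows lam_lam: "lam r a (lam r b c) = lam r (lam r a b) (lam r (rho r b a) c)"
    and lam_rho: "lam r (rho r (lam r b c) a) (rho r c b) = rho r (lam r (rho r b a) c) (lam r a b)"
    and rho_rho: "rho r c (rho r b a) = rho r (rho r c b) (rho r (lam r b c) a)"
proof -
  have "(on12 r \<circ> on23 r \<circ> on12 r) (a, b, c) = (on23 r \<circ> on12 r \<circ> on23 r) (a, b, c)"
    using rnd assms unfolding rnd_solution_def ybe_solution_def by blast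
  then show "lam r a (lam r b c) = lam r (lam r a b) (lam r (rho r b a) c)"
    "lam r (rho r (lam r b c) a) (rho r c b) = rho r (lam r (rho r b a) c) (lam r a b)"
    "rho r c (rho r b a) = rho r (rho r c b) (rho r (lam r b c) a)"
    by (simp_all add: on12_def on23_def r_eq)
qed

lemma
  assumes "a \<in> X" "b \<in> X"
  shows reflection_lam:
      "lam r (lam r a (k b)) (k (rho r (k b) a)) = lam r (lam r a b) (k (rho r b a))"
    and reflection_rho:
      "rho r (k (rho r (k b) a)) (lam r a (k b)) = k (rho r (k (rho r b a)) (lam r a b))"
proof -
  have "(r \<circ> on2 k \<circ> r \<circ> on2 k) (a, b) = (on2 k \<circ> r \<circ> on2 k \<circ> r) (a, b)"
    using refl assms unfolding reflection_def by blast
  then show "lam r (lam r a (k b)) (k (rho r (k b) a)) = lam r (lam r a b) (k (rho r b a))"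
    "rho r (k (rho r (k b) a)) (lam r a (k b)) = k (rho r (k (rho r b a)) (lam r a b))"
    by (simp_all add: on2_def r_eq)
qed

lemma derived_solution_closed: "derived_solution X r k \<in> X \<times> X \<rightarrow> X \<times> X"
  by (auto simp: derived_solution_def Let_def)

lemma btri_closed: "a \<in> X \<Longrightarrow> b \<in> X \<Longrightarrow> btri X r k a b \<in> X"
  by (simp add: btri_def)

lemma btri_rho_self:
  "a \<in> X \<Longrightarrow> u \<in> X \<Longrightarrow> btri X r k a (rho r a u) = rho r (k (rho r a u)) (lam r u a)"
  by (simp add: btri_def)

text \<open>
  By \<open>rho_rho\<close> the second argument is $\rho_{\rho_v(y)}$ of $\rho_{\lambda_y(v)}(t)$, which
  makes \<open>btri_rho_self\<close> applicable; then \<open>lam_rho\<close> pulls $\rho$ outside.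
\<close>

lemma btri_rho:
  assumes "t \<in> X" "y \<in> X" "v \<in> X"
  shows "btri X r k (rho r v y) (rho r v (rho r y t)) =
    rho r (k (rho r v (rho r y t))) (rho r (lam r (rho r y t) v) (lam r t y))"
proof -
  have "btri X r k (rho r v y) (rho r v (rho r y t)) =
      rho r (k (rho r v (rho r y t))) (lam r (rho r (lam r y v) t) (rho r v y))"
    using btri_rho_self[of "rho r v y" "rho r (lam r y v) t"] rho_rho[of t y v] assms by simp
  then show ?thesis
    using lam_rho[of t y v] assms by simp
qed

text \<open>
  Written for $a'$ and $b$, the relation $b' = b \blacktriangleleft a'$ holds, so this is a form of
  self-distributivity, twisted in that $a$ on the left differs from $a'$ on the right.
\<close>

lemma btri_compatible:
  assumes X: "a \<in> X" "b \<in> X" "x \<in> X" and s: "derived_solution X r k (a, b) = (b', a')"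
  shows "btri X r k (btri X r k x b) a = btri X r k (btri X r k x a') b'"
proof -
  define p where "p = rho_inv X r (k b) a"
  define q where "q = rho_inv X r x b"
  define y where "y = lam r q x"
  define t where "t = rho_inv X r y p"
  define z where "z = lam r (rho r q t) x"
  define c where "c = lam r p b"
  define d where "d = lam r p (k b)"
  have closed [simp]: "p \<in> X" "q \<in> X" "y \<in> X" "t \<in> X" "z \<in> X" "c \<in> X" "d \<in> X"
    using X by (simp_all add: p_def q_def y_def t_def z_def c_def d_def)
  have a: "a = rho r (k b) p" and b: "b = rho r x q" and p: "p = rho r y t"
    using X by (simp_all add: p_def q_def t_def)
  have a': "a' = rho r b p" and b': "b' = rho r (k a') c"
    using s by (auto simp: derived_solution_def Let_def p_def c_def)
  have [simp]: "a' \<in> X"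
    using a' X by simp
  have a'_x: "a' = rho r x (rho r q t)"
    unfolding a' p using rho_rho[of t q x] X by (simp add: b[symmetric] y_def)
  have c: "c = rho r z (lam r t q)"
    using lam_rho[of t q x] X by (simp add: c_def z_def b[symmetric] y_def[symmetric] p[symmetric])
  have crossed: "lam r t y = lam r (lam r t q) z"
    using lam_lam[of t q x] X by (simp add: y_def z_def)
  have xb: "btri X r k x b = rho r (k b) y"
    using btri_rho_self[of x q] X by (simp add: b[symmetric] y_def)
  have xa': "btri X r k x a' = rho r (k a') z"
    using btri_rho_self[of x "rho r q t"] X by (simp add: a'_x[symmetric] z_def)
  \<comment> \<open>Here \<open>btri_rho\<close> applies to the left side at \<open>(t, y, k b)\<close>, to the right side at
    \<open>(lam r t q, z, k a')\<close>; \<open>crossed\<close> identifies the innermost arguments that result.\<close>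
  have "btri X r k (btri X r k x b) a = rho r (k a) (rho r d (lam r t y))"
    using btri_rho[of t y "k b"] X by (simp add: xb a[symmetric] p[symmetric] d_def)
  also have "\<dots> = rho r (rho r (k a) d) (rho r (lam r d (k a)) (lam r t y))"
    using X by (intro rho_rho) simp_all
  also have "rho r (k a) d = k b'"
    using reflection_rho[of p b] X by (simp add: a[symmetric] a'[symmetric] b' c_def d_def)
  also have "lam r d (k a) = lam r c (k a')"
    using reflection_lam[of p b] X by (simp add: a[symmetric] a'[symmetric] c_def d_def)
  also have "rho r (k b') (rho r (lam r c (k a')) (lam r t y)) = btri X r k (btri X r k x a') b'"
    using btri_rho[of "lam r t q" z "k a'"]
    by (simp add: xa' c[symmetric] b'[symmetric] crossed)
  finally show ?thesis .
qed

end

theorem proposition2p7: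
  fixes X :: "'a set" and r :: "'a \<times> 'a \<Rightarrow> 'a \<times> 'a" and k :: "'a \<Rightarrow> 'a"
  assumes "rnd_solution X r" and "reflection X r k"
  shows "\<exists>act. left_monoid_action (structure_monoid X (derived_solution X r k)) X act \<and>
    (\<forall>b \<in> X. \<forall>a \<in> X. act (generator X (derived_solution X r k) b) a = btri X r k a b)"
proof -
  interpret rnd_with_reflection X r k
    using assms by unfold_locales
  show ?thesis
    by (rule structure_monoid_action[OF derived_solution_closed, where f = "\<lambda>b a. btri X r k a b"])
      (auto intro: btri_closed btri_compatible)
qed

end
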